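(* Let $K:X\to Y$ be a linear, compact and injective operator between infinite-dimensional separable real Hilbert spaces, let $\{\phi_i\}_{i=1}^\infty$ be an orthonormal basis of $X$, let $k\ge 1$ and $\tau>0$, and let $K_k$, $K_k^\dagger$, $P_k$ and the weights $w_{k,i}$ be as defined in the context. Fix an index $j$ with $\|P_k\phi_j\|\ge\tau$ and let $\alpha\in(0,\|P_k\phi_j\|)$. Then $$x=\left(1-\frac{\alpha}{\|P_k\phi_j\|}\right)\phi_j$$ solves $$\min_{x\in X}\left\{\frac12\|P_kx-K_k^\dagger K\phi_j\|^2+\alpha\sum_i w_{k,i}|(x,\phi_i)|\right\}.$$ Furthermore, if in addition $$K_k\phi_l\ne c\,K_k\phi_q\quad\text{for all } l\ne q \text{ and all } c\in\mathbb{R},$$ then this $x$ is the unique solution of the minimization problem.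
   Context: $(\cdot,\cdot)$ and $\|\cdot\|$ denote the inner product and norm of $X$ or $Y$, according to context. Let $(v_i,u_i;\sigma_i)_{i\ge1}$ be a singular system of $K$, so that $Kx=\sum_{i=1}^\infty\sigma_i(x,v_i)u_i$ with $\sigma_1\ge\sigma_2\ge\cdots>0$, where $\{v_i\}$ is an orthonormal basis of $X$ ($K$ being injective) and $\{u_i\}$ is orthonormal in $Y$. For $k\ge1$ the truncated operator is $K_kx=\sum_{i=1}^k\sigma_i(x,v_i)u_i$, its pseudo-inverse is $K_k^\dagger y=\sum_{i=1}^k\sigma_i^{-1}(y,u_i)v_i$, and $P_k=K_k^\dagger K_k$ is the orthogonal projection of $X$ onto $\mathcal{N}(K_k)^\perp=\mathrm{span}\{v_1,\ldots,v_k\}$. Given a threshold $\tau>0$, the weights are $w_{k,i}=\|P_k\phi_i\|$ if $\|P_k\phi_i\|\ge\tau$ and $w_{k,i}=\tau$ if $\|P_k\phi_i\|<\tau$. The sum $\sum_i w_{k,i}|(x,\phi_i)|$ runs over all $i\ge1$ and may be $+\infty$; "solves" means is a global minimizer over $X$. *)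

theory Defs
  imports "HOL-Analysis.Analysis"
begin

text \<open>
  Sequences indexed by $i \ge 1$ in the mathematics are indexed by \<^typ>\<open>nat\<close> starting at \<open>0\<close> here,
  so that the indices $1, \ldots, k$ become \<open>{..<k}\<close>.
\<close>

definition infinite_dimensional :: "'a::real_vector itself \<Rightarrow> bool" where
  "infinite_dimensional _ \<longleftrightarrow> \<not> (\<exists>B::'a set. finite B \<and> span B = UNIV)"

definition orthonormal_seq :: "(nat \<Rightarrow> 'a::real_inner) \<Rightarrow> bool" where
  "orthonormal_seq e \<longleftrightarrow> (\<forall>i j. e i \<bullet> e j = (if i = j then 1 else 0))"

definition orthonormal_basis :: "(nat \<Rightarrow> 'a::real_inner) \<Rightarrow> bool" where
  "orthonormal_basis e \<longleftrightarrow> orthonormal_seq e \<and> closure (span (range e)) = UNIV"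

definition compact_operator :: "('a::real_normed_vector \<Rightarrow> 'b::real_normed_vector) \<Rightarrow> bool" where
  "compact_operator K \<longleftrightarrow> linear K \<and> (\<forall>S. bounded S \<longrightarrow> compact (closure (K ` S)))"

text \<open>
  A singular system of an injective operator: injectivity is what makes \<open>v\<close> a basis of the whole
  space rather than of the orthogonal complement of the kernel.
\<close>

definition singular_system ::
  "('a::real_inner \<Rightarrow> 'b::real_inner) \<Rightarrow> (nat \<Rightarrow> 'a) \<Rightarrow> (nat \<Rightarrow> 'b) \<Rightarrow> (nat \<Rightarrow> real) \<Rightarrow> bool" where
  "singular_system K v u \<sigma> \<longleftrightarrow>
     orthonormal_basis v \<and> orthonormal_seq u \<and> decseq \<sigma> \<and> (\<forall>i. 0 < \<sigma> i) \<and>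
     (\<forall>x. (\<lambda>i. (\<sigma> i * (x \<bullet> v i)) *\<^sub>R u i) sums K x)"

definition trunc_op ::
  "(nat \<Rightarrow> 'a::real_inner) \<Rightarrow> (nat \<Rightarrow> 'b::real_inner) \<Rightarrow> (nat \<Rightarrow> real) \<Rightarrow> nat \<Rightarrow> 'a \<Rightarrow> 'b" where
  "trunc_op v u \<sigma> k x = (\<Sum>i<k. (\<sigma> i * (x \<bullet> v i)) *\<^sub>R u i)"

definition trunc_pinv ::
  "(nat \<Rightarrow> 'a::real_inner) \<Rightarrow> (nat \<Rightarrow> 'b::real_inner) \<Rightarrow> (nat \<Rightarrow> real) \<Rightarrow> nat \<Rightarrow> 'b \<Rightarrow> 'a" where
  "trunc_pinv v u \<sigma> k y = (\<Sum>i<k. (inverse (\<sigma> i) * (y \<bullet> u i)) *\<^sub>R v i)"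

definition trunc_proj ::
  "(nat \<Rightarrow> 'a::real_inner) \<Rightarrow> (nat \<Rightarrow> 'b::real_inner) \<Rightarrow> (nat \<Rightarrow> real) \<Rightarrow> nat \<Rightarrow> 'a \<Rightarrow> 'a" where
  "trunc_proj v u \<sigma> k = trunc_pinv v u \<sigma> k \<circ> trunc_op v u \<sigma> k"

definition weight :: "('a::real_inner \<Rightarrow> 'a) \<Rightarrow> (nat \<Rightarrow> 'a) \<Rightarrow> real \<Rightarrow> nat \<Rightarrow> real" where
  "weight P \<phi> \<tau> i = (if norm (P (\<phi> i)) \<ge> \<tau> then norm (P (\<phi> i)) else \<tau>)"

text \<open>
  The penalty is a series of nonnegative terms in \<^typ>\<open>ereal\<close>, so it takes the value \<open>\<infinity>\<close> exactly
  when the real series diverges.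
\<close>

definition weighted_l1_objective ::
  "('a::real_inner \<Rightarrow> 'a) \<Rightarrow> 'a \<Rightarrow> real \<Rightarrow> (nat \<Rightarrow> real) \<Rightarrow> (nat \<Rightarrow> 'a) \<Rightarrow> 'a \<Rightarrow> ereal" where
  "weighted_l1_objective P b \<alpha> w \<phi> x =
     ereal (1/2 * (norm (P x - b))\<^sup>2) + ereal \<alpha> * (\<Sum>i. ereal (w i * \<bar>x \<bullet> \<phi> i\<bar>))"

definition global_minimizer :: "('a \<Rightarrow> ereal) \<Rightarrow> 'a \<Rightarrow> bool" where
  "global_minimizer F x \<longleftrightarrow> (\<forall>y. F x \<le> F y)"

end

theory Submission
  imports Defs
begin

text \<open>
  Write \<open>p = P\<^sub>k \<phi>\<^sub>j\<close>, \<open>n = \<parallel>p\<parallel>\<close>; the singular system gives \<open>K\<^sub>k\<^sup>\<dagger> K \<phi>\<^sub>j = p\<close>. For \<open>y\<close> with finite penalty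
  sum \<open>S\<close>, expanding \<open>y\<close> in the basis gives \<open>(P\<^sub>k y, p) \<le> n S\<close>, because the weights dominate
  \<open>\<parallel>P\<^sub>k \<phi>\<^sub>i\<parallel>\<close>. Hence \<open>t = \<parallel>P\<^sub>k y - p\<parallel> \<ge> n - S\<close>, and \<open>t\<^sup>2/2 + \<alpha> S \<ge> \<alpha> t - \<alpha>\<^sup>2/2 + \<alpha> S \<ge> \<alpha> n - \<alpha>\<^sup>2/2\<close>,
  which is the value at the claimed minimizer. Equality forces equality in Cauchy-Schwarz for
  every \<open>i\<close> with \<open>(y, \<phi>\<^sub>i) \<noteq> 0\<close>, so that \<open>P\<^sub>k \<phi>\<^sub>i\<close> is a multiple of \<open>p\<close>.
\<close>

section \<open>Orthonormal sequences and Fourier expansions\<close>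

lemma orthonormal_seq_inner:
  "orthonormal_seq e \<Longrightarrow> e i \<bullet> e j = (if i = j then 1 else 0)"
  by (simp add: orthonormal_seq_def)

lemma orthonormal_seq_inner_sum:
  assumes "orthonormal_seq e"
  shows "(\<Sum>i<n. c i *\<^sub>R e i) \<bullet> e m = (if m < n then c m else 0)"
proof -
  have "(\<Sum>i<n. c i *\<^sub>R e i) \<bullet> e m = (\<Sum>i<n. if i = m then c i else 0)"
    unfolding inner_sum_left by (rule sum.cong) (simp_all add: orthonormal_seq_inner[OF assms])
  then show ?thesis by simp
qed

lemma orthonormal_seq_sums_inner:
  assumes "orthonormal_seq e" and "(\<lambda>i. c i *\<^sub>R e i) sums y"
  shows "y \<bullet> e m = c m"
proof -
  have "(\<lambda>i. (c i *\<^sub>R e i) \<bullet> e m) sums (y \<bullet> e m)"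
    by (rule bounded_linear.sums[OF bounded_linear_inner_left assms(2)])
  moreover have "(\<lambda>i. (c i *\<^sub>R e i) \<bullet> e m) = (\<lambda>i. if i = m then c i else 0)"
    by (auto simp: orthonormal_seq_inner[OF assms(1)])
  ultimately show ?thesis
    using sums_single[of m c] sums_unique2 by metis
qed

text \<open>Pythagoras: the partial Fourier sum is orthogonal to the residual. The bound is uniform
  in \<open>n\<close>, which lets convergence of Fourier sums pass from a dense subspace to the
  whole space.\<close>

lemma orthonormal_seq_residual_norm_le:
  assumes "orthonormal_seq e"
  shows "norm (y - (\<Sum>i<n. (y \<bullet> e i) *\<^sub>R e i)) \<le> norm y"
proof -
  let ?s = "\<Sum>i<n. (y \<bullet> e i) *\<^sub>R e i"
  have "?s \<bullet> ?s = (\<Sum>i<n. (y \<bullet> e i)\<^sup>2)"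
    unfolding inner_sum_right
    by (simp add: orthonormal_seq_inner_sum[OF assms] power2_eq_square)
  moreover have "y \<bullet> ?s = (\<Sum>i<n. (y \<bullet> e i)\<^sup>2)"
    by (simp add: inner_sum_right power2_eq_square)
  ultimately have "(y - ?s) \<bullet> (y - ?s) \<le> y \<bullet> y"
    by (simp add: inner_diff_left inner_diff_right inner_commute sum_nonneg)
  then show ?thesis
    by (simp add: norm_le)
qed

lemma orthonormal_basis_sums:
  assumes "orthonormal_basis e"
  shows "(\<lambda>i. (y \<bullet> e i) *\<^sub>R e i) sums y"
proof -
  have on: "orthonormal_seq e" and dense: "closure (span (range e)) = UNIV"
    using assms by (auto simp: orthonormal_basis_def)
  \<comment> \<open>The vectors represented by their Fourier series form a subspace containing each
    \<open>e m\<close>, hence the span; density then handles the remaining vectors.\<close>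
  define A where "A = {z. (\<lambda>i. (z \<bullet> e i) *\<^sub>R e i) sums z}"
  have "subspace A"
    unfolding subspace_def A_def
    by (auto simp: inner_add_left scaleR_add_left intro: sums_add
        dest: sums_scaleR_right)
  moreover have "range e \<subseteq> A"
  proof safe
    fix m
    have "(\<lambda>i. (e m \<bullet> e i) *\<^sub>R e i) = (\<lambda>i. if i = m then e i else 0)"
      by (auto simp: orthonormal_seq_inner[OF on])
    then show "e m \<in> A"
      using sums_single[of m e] by (simp add: A_def)
  qed
  ultimately have span: "span (range e) \<subseteq> A"
    by (simp add: span_minimal)
  show ?thesis
    unfolding sums_def
  proof (rule LIMSEQ_I)
    fix r :: real
    assume "0 < r"
    obtain z where z: "z \<in> span (range e)" "dist z y < r / 2"
      using dense \<open>0 < r\<close> by (metis UNIV_I closure_approachable half_gt_zero)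
    have "(\<lambda>n. \<Sum>i<n. (z \<bullet> e i) *\<^sub>R e i) \<longlonglongrightarrow> z"
      using z(1) span by (auto simp: A_def sums_def)
    then obtain N where N: "\<And>n. n \<ge> N \<Longrightarrow> norm ((\<Sum>i<n. (z \<bullet> e i) *\<^sub>R e i) - z) < r / 2"
      using LIMSEQ_D[of _ z "r / 2"] \<open>0 < r\<close> by auto
    have "norm ((\<Sum>i<n. (y \<bullet> e i) *\<^sub>R e i) - y) < r" if "n \<ge> N" for n
    proof -
      \<comment> \<open>The error at \<open>y\<close> splits into the error \<open>?a\<close> at the
        nearby \<open>z\<close>, small for large \<open>n\<close>, and the residual
        \<open>?b\<close> of \<open>y - z\<close>, bounded by \<open>norm (y - z)\<close> for every
        \<open>n\<close>.\<close>
      let ?a = "(\<Sum>i<n. (z \<bullet> e i) *\<^sub>R e i) - z"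
      let ?b = "(y - z) - (\<Sum>i<n. ((y - z) \<bullet> e i) *\<^sub>R e i)"
      have "norm ((\<Sum>i<n. (y \<bullet> e i) *\<^sub>R e i) - y) = norm (?a - ?b)"
        by (simp add: inner_diff_left scaleR_diff_left sum_subtractf)
      moreover have "norm ?b < r / 2"
        using orthonormal_seq_residual_norm_le[OF on, of "y - z" n] z(2)
        by (simp add: dist_norm norm_minus_commute)
      ultimately show ?thesis
        using N[OF that] norm_triangle_ineq4[of ?a ?b] by linarith
    qed
    then show "\<exists>no. \<forall>n\<ge>no. norm ((\<Sum>i<n. (y \<bullet> e i) *\<^sub>R e i) - y) < r"
      by blast
  qed
qed

section \<open>Finiteness of the objective and its value at the claimed minimizer\<close>

lemma weighted_l1_objective_cases:
  assumes "0 < \<alpha>" and "\<And>i. 0 \<le> w i"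
  obtains "weighted_l1_objective P b \<alpha> w \<phi> y = \<infinity>"
  | "summable (\<lambda>i. w i * \<bar>y \<bullet> \<phi> i\<bar>)"
    "weighted_l1_objective P b \<alpha> w \<phi> y =
      ereal (1/2 * (norm (P y - b))\<^sup>2 + \<alpha> * (\<Sum>i. w i * \<bar>y \<bullet> \<phi> i\<bar>))"
proof (cases "(\<Sum>i. ereal (w i * \<bar>y \<bullet> \<phi> i\<bar>)) = \<infinity>")
  case True
  then show ?thesis
    using that(1) assms(1) by (simp add: weighted_l1_objective_def)
next
  case False
  have "summable (\<lambda>i. w i * \<bar>y \<bullet> \<phi> i\<bar>)"
    by (rule summable_ereal) (use False assms(2) in simp_all)
  moreover from this have "(\<Sum>i. ereal (w i * \<bar>y \<bullet> \<phi> i\<bar>)) = ereal (\<Sum>i. w i * \<bar>y \<bullet> \<phi> i\<bar>)"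
    by (rule suminf_ereal')
  ultimately show ?thesis
    using that(2) by (simp add: weighted_l1_objective_def)
qed

text \<open>With \<open>n = norm (P (\<phi> j))\<close>, the penalty has the single nonzero term
  \<open>n - \<alpha>\<close> and the residual has norm \<alpha>, so the value is
  \<open>\<alpha>\<^sup>2 / 2 + \<alpha> * (n - \<alpha>)\<close>.\<close>

lemma weighted_l1_objective_atom:
  assumes "orthonormal_seq \<phi>" and "linear P" and "w j = norm (P (\<phi> j))" and "0 \<le> \<alpha>"
    and "\<alpha> < norm (P (\<phi> j))"
  shows "weighted_l1_objective P (P (\<phi> j)) \<alpha> w \<phi> ((1 - \<alpha> / norm (P (\<phi> j))) *\<^sub>R \<phi> j) =
    ereal (\<alpha> * norm (P (\<phi> j)) - \<alpha>\<^sup>2 / 2)"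
proof -
  let ?n = "norm (P (\<phi> j))"
  let ?x = "(1 - \<alpha> / ?n) *\<^sub>R \<phi> j"
  have n: "?n > 0"
    using assms(4,5) by linarith
  have "(\<lambda>i. ereal (w i * \<bar>?x \<bullet> \<phi> i\<bar>)) = (\<lambda>i. if i = j then ereal (?n - \<alpha>) else 0)"
    using assms(3,5) n by (auto simp: orthonormal_seq_inner[OF assms(1)] zero_ereal_def field_simps)
  then have pen: "(\<Sum>i. ereal (w i * \<bar>?x \<bullet> \<phi> i\<bar>)) = ereal (?n - \<alpha>)"
    using sums_single[of j "\<lambda>_. ereal (?n - \<alpha>)"] by (metis sums_unique)
  have "P ?x - P (\<phi> j) = - (\<alpha> / ?n) *\<^sub>R P (\<phi> j)"
    by (simp add: linear_diff[OF assms(2)] linear_scale[OF assms(2)] algebra_simps)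
  then have "norm (P ?x - P (\<phi> j)) = \<alpha>"
    using n assms(4) by (auto simp del: scaleR_minus_left)
  then show ?thesis
    unfolding weighted_l1_objective_def pen
    by (simp add: field_simps power2_eq_square)
qed

section \<open>Minimization for a bounded operator whose norms on the basis are dominated by the
  weights\<close>

context
  fixes P :: "'a::real_inner \<Rightarrow> 'a" and \<phi> :: "nat \<Rightarrow> 'a" and w :: "nat \<Rightarrow> real"
    and j :: nat
  assumes basis: "orthonormal_basis \<phi>" and bl: "bounded_linear P"
    and weight_ge: "\<And>i. norm (P (\<phi> i)) \<le> w i"
begin

text \<open>Both \<open>P\<close> and the inner product with \<open>p\<close> are linear and
  continuous, so they pass through the Fourier series of \<open>y\<close>.\<close>

lemma inner_atom_sums: "(\<lambda>i. (y \<bullet> \<phi> i) * (P (\<phi> i) \<bullet> p)) sums (P y \<bullet> p)"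
proof -
  have "(\<lambda>i. P ((y \<bullet> \<phi> i) *\<^sub>R \<phi> i) \<bullet> p) sums (P y \<bullet> p)"
    by (intro bounded_linear.sums[OF bounded_linear_inner_left] bounded_linear.sums[OF bl]
        orthonormal_basis_sums basis)
  then show ?thesis
    by (simp add: linear_scale[OF bounded_linear.linear[OF bl]])
qed

lemma inner_atom_term_le:
  "(y \<bullet> \<phi> i) * (P (\<phi> i) \<bullet> p) \<le> w i * \<bar>y \<bullet> \<phi> i\<bar> * norm p"
proof -
  have "(y \<bullet> \<phi> i) * (P (\<phi> i) \<bullet> p) \<le> \<bar>y \<bullet> \<phi> i\<bar> * \<bar>P (\<phi> i) \<bullet> p\<bar>"
    by (metis abs_ge_self abs_mult)
  also have "\<dots> \<le> \<bar>y \<bullet> \<phi> i\<bar> * (norm (P (\<phi> i)) * norm p)"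
    by (intro mult_left_mono Cauchy_Schwarz_ineq2) simp
  also have "\<dots> \<le> \<bar>y \<bullet> \<phi> i\<bar> * (w i * norm p)"
    by (intro mult_left_mono mult_right_mono weight_ge) simp_all
  finally show ?thesis
    by (simp add: mult_ac)
qed

lemma inner_le_penalty:
  assumes "summable (\<lambda>i. w i * \<bar>y \<bullet> \<phi> i\<bar>)"
  shows "P y \<bullet> p \<le> (\<Sum>i. w i * \<bar>y \<bullet> \<phi> i\<bar>) * norm p"
  by (rule sums_le[OF inner_atom_term_le inner_atom_sums sums_mult2[OF summable_sums[OF assms]]])

text \<open>The bound \<open>inner_le_penalty\<close> comes from a termwise one, so the gaps
  \<open>?g\<close> are nonnegative with sum zero and all vanish. Each term with a nonzero
  coefficient then attains equality in Cauchy-Schwarz.\<close>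

lemma inner_eq_penalty_imp_collinear:
  assumes sm: "summable (\<lambda>i. w i * \<bar>y \<bullet> \<phi> i\<bar>)"
    and eq: "P y \<bullet> p = (\<Sum>i. w i * \<bar>y \<bullet> \<phi> i\<bar>) * norm p"
    and "p \<noteq> 0" and "y \<bullet> \<phi> i \<noteq> 0"
  shows "\<exists>c. P (\<phi> i) = c *\<^sub>R p"
proof -
  let ?g = "\<lambda>i. w i * \<bar>y \<bullet> \<phi> i\<bar> * norm p - (y \<bullet> \<phi> i) * (P (\<phi> i) \<bullet> p)"
  have "?g sums ((\<Sum>i. w i * \<bar>y \<bullet> \<phi> i\<bar>) * norm p - P y \<bullet> p)"
    by (intro sums_diff sums_mult2 summable_sums sm inner_atom_sums)
  then have "?g sums 0"
    by (simp add: eq)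
  then have "summable ?g" "suminf ?g = 0"
    by (auto simp: sums_iff)
  moreover have "0 \<le> ?g m" for m
    using inner_atom_term_le[of y m p] by simp
  ultimately have "?g i = 0"
    using suminf_eq_zero_iff[of ?g] by blast
  then have "w i * \<bar>y \<bullet> \<phi> i\<bar> * norm p \<le> \<bar>y \<bullet> \<phi> i\<bar> * \<bar>P (\<phi> i) \<bullet> p\<bar>"
    using abs_ge_self[of "(y \<bullet> \<phi> i) * (P (\<phi> i) \<bullet> p)"] unfolding abs_mult by linarith
  \<comment> \<open>Cancelling the nonzero coefficient gives the reverse of the Cauchy-Schwarz
    bound, since \<open>w i\<close> dominates \<open>norm (P (\<phi> i))\<close>.\<close>
  then have "w i * norm p \<le> \<bar>P (\<phi> i) \<bullet> p\<bar>"
    using assms(4) by (simp add: mult.assoc mult.left_commute[of "w i"])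
  moreover have "norm (P (\<phi> i)) * norm p \<le> w i * norm p"
    by (intro mult_right_mono weight_ge) simp
  ultimately have "\<bar>P (\<phi> i) \<bullet> p\<bar> = norm (P (\<phi> i)) * norm p"
    using Cauchy_Schwarz_ineq2[of "P (\<phi> i)" p] by linarith
  then have "norm (P (\<phi> i)) *\<^sub>R p = norm p *\<^sub>R P (\<phi> i) \<or>
      norm (P (\<phi> i)) *\<^sub>R p = - (norm p *\<^sub>R P (\<phi> i))"
    by (simp add: norm_cauchy_schwarz_abs_eq)
  then obtain c where "norm p *\<^sub>R P (\<phi> i) = c *\<^sub>R p"
    by (metis minus_minus scaleR_minus_left)
  then have "P (\<phi> i) = (c / norm p) *\<^sub>R p"
    using assms(3) by (simp add: vector_fraction_eq_iff eq_vector_fraction_iff)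
  then show ?thesis by blast
qed

context
  fixes \<alpha> :: real
  assumes weight_eq: "w j = norm (P (\<phi> j))" and alpha: "0 < \<alpha>" "\<alpha> < norm (P (\<phi> j))"
begin

lemma weight_nonneg: "0 \<le> w i"
  using weight_ge[of i] norm_ge_zero[of "P (\<phi> i)"] by linarith

text \<open>Cauchy-Schwarz for \<open>P y - P (\<phi> j)\<close> against
  \<open>P (\<phi> j)\<close>, combined with \<open>inner_le_penalty\<close>. When the bound is
  tight, these two inequalities enclose the inner product from both sides.\<close>

lemma penalty_ge:
  assumes "summable (\<lambda>i. w i * \<bar>y \<bullet> \<phi> i\<bar>)"
  shows "norm (P (\<phi> j)) - (\<Sum>i. w i * \<bar>y \<bullet> \<phi> i\<bar>) \<le> norm (P y - P (\<phi> j))"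
    and "norm (P (\<phi> j)) - (\<Sum>i. w i * \<bar>y \<bullet> \<phi> i\<bar>) = norm (P y - P (\<phi> j)) \<Longrightarrow>
      P y \<bullet> P (\<phi> j) = (\<Sum>i. w i * \<bar>y \<bullet> \<phi> i\<bar>) * norm (P (\<phi> j))"
proof -
  let ?p = "P (\<phi> j)" and ?S = "\<Sum>i. w i * \<bar>y \<bullet> \<phi> i\<bar>"
  have n: "norm ?p > 0"
    using alpha by linarith
  have le: "P y \<bullet> ?p \<le> ?S * norm ?p"
    by (rule inner_le_penalty[OF assms])
  have "(norm ?p)\<^sup>2 - P y \<bullet> ?p = - (P y - ?p) \<bullet> ?p"
    by (simp add: inner_diff_left power2_norm_eq_inner)
  also have "\<dots> \<le> norm (P y - ?p) * norm ?p"
    by (metis norm_cauchy_schwarz norm_minus_cancel)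
  finally have cs: "(norm ?p)\<^sup>2 - P y \<bullet> ?p \<le> norm (P y - ?p) * norm ?p" .
  have "(norm ?p - ?S) * norm ?p \<le> norm (P y - ?p) * norm ?p"
    using cs le by (simp add: algebra_simps power2_eq_square)
  then show "norm ?p - ?S \<le> norm (P y - ?p)"
    using n by simp
  assume eq: "norm ?p - ?S = norm (P y - ?p)"
  show "P y \<bullet> ?p = ?S * norm ?p"
    using cs le unfolding eq[symmetric] by (simp add: algebra_simps power2_eq_square)
qed

lemma objective_lower_bound:
  "ereal (\<alpha> * norm (P (\<phi> j)) - \<alpha>\<^sup>2 / 2) \<le> weighted_l1_objective P (P (\<phi> j)) \<alpha> w \<phi> y"
proof (cases rule: weighted_l1_objective_cases[where w = w and P = P and b = "P (\<phi> j)" and \<phi> = \<phi>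
      and y = y, OF alpha(1) weight_nonneg])
  case 2
  let ?t = "norm (P y - P (\<phi> j))" and ?S = "\<Sum>i. w i * \<bar>y \<bullet> \<phi> i\<bar>"
  have "\<alpha> * (norm (P (\<phi> j)) - ?S) \<le> \<alpha> * ?t"
    using penalty_ge(1)[OF 2(1)] alpha(1) by simp
  \<comment> \<open>Expanded, this bounds \<open>?t\<^sup>2 / 2\<close> below by its tangent line at
    \<alpha>, namely \<open>\<alpha> * ?t - \<alpha>\<^sup>2 / 2\<close>.\<close>
  moreover have "0 \<le> (?t - \<alpha>)\<^sup>2"
    by simp
  ultimately show ?thesis
    unfolding 2(2) by (simp add: algebra_simps power2_eq_square)
qed simp

text \<open>Attaining the lower bound turns every inequality behind it into an equality.
  Non-collinearity then kills all coefficients except the one at \<open>j\<close>, which the value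
  of the penalty determines.\<close>

lemma objective_minimum_unique:
  assumes noncollinear: "\<And>i c. i \<noteq> j \<Longrightarrow> P (\<phi> i) \<noteq> c *\<^sub>R P (\<phi> j)"
    and min: "weighted_l1_objective P (P (\<phi> j)) \<alpha> w \<phi> y = ereal (\<alpha> * norm (P (\<phi> j)) - \<alpha>\<^sup>2 / 2)"
  shows "y = (1 - \<alpha> / norm (P (\<phi> j))) *\<^sub>R \<phi> j"
proof (cases rule: weighted_l1_objective_cases[where w = w and P = P and b = "P (\<phi> j)" and \<phi> = \<phi>
      and y = y, OF alpha(1) weight_nonneg])
  case 2
  let ?p = "P (\<phi> j)"
  let ?t = "norm (P y - ?p)" and ?S = "\<Sum>i. w i * \<bar>y \<bullet> \<phi> i\<bar>"
  let ?c = "y \<bullet> \<phi> j"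
  have n: "norm ?p > 0"
    using alpha by linarith
  have le: "\<alpha> * (norm ?p - ?S) \<le> \<alpha> * ?t"
    using penalty_ge(1)[OF 2(1)] alpha(1) by simp
  have "1/2 * ?t\<^sup>2 + \<alpha> * ?S = \<alpha> * norm ?p - \<alpha>\<^sup>2 / 2"
    using min unfolding 2(2) by simp
  \<comment> \<open>The left side is nonnegative and, by \<open>le\<close>, the right side is
    nonpositive; hence both vanish.\<close>
  then have sq: "(?t - \<alpha>)\<^sup>2 / 2 = \<alpha> * (norm ?p - ?S) - \<alpha> * ?t"
    by (simp add: field_simps power2_eq_square)
  then have "(?t - \<alpha>)\<^sup>2 \<le> 0"
    using le by linarith
  then have t: "?t = \<alpha>"
    by simp
  then have "\<alpha> * (norm ?p - ?S) = \<alpha> * \<alpha>"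
    using sq by simp
  then have S: "norm ?p - ?S = \<alpha>"
    using alpha(1) by simp
  have eq: "P y \<bullet> ?p = ?S * norm ?p"
    by (rule penalty_ge(2)[OF 2(1)]) (simp add: S t)
  have zero: "y \<bullet> \<phi> i = 0" if "i \<noteq> j" for i
    using inner_eq_penalty_imp_collinear[OF 2(1) eq, of i] noncollinear[OF that] n by auto
  have "(\<lambda>i. (y \<bullet> \<phi> i) *\<^sub>R \<phi> i) = (\<lambda>i. if i = j then ?c *\<^sub>R \<phi> j else 0)"
    using zero by auto
  then have y: "y = ?c *\<^sub>R \<phi> j"
    using orthonormal_basis_sums[OF basis, of y] sums_single[of j "\<lambda>_. ?c *\<^sub>R \<phi> j"] sums_unique2
    by metis
  have "P y = ?c *\<^sub>R ?p"
    by (metis y linear_scale[OF bounded_linear.linear[OF bl]])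
  \<comment> \<open>Substituting into \<open>eq\<close> yields the signed coefficient directly, so
    the absolute value in the penalty needs no case split.\<close>
  then have "?c * norm ?p = ?S"
    using eq n by (simp add: power2_norm_eq_inner[symmetric] power2_eq_square)
  then have "?c = 1 - \<alpha> / norm ?p"
    using S n by (simp add: field_simps)
  then show ?thesis
    using y by simp
qed (use min in simp)

end

end

section \<open>Truncated operators of a singular system\<close>

lemma trunc_op_inner:
  assumes "orthonormal_seq u" and "m < k"
  shows "trunc_op v u \<sigma> k y \<bullet> u m = \<sigma> m * (y \<bullet> v m)"
  using assms(2) by (simp add: trunc_op_def orthonormal_seq_inner_sum[OF assms(1)])

lemma trunc_proj_eq:
  assumes "orthonormal_seq u" and "\<And>i. 0 < \<sigma> i"
  shows "trunc_proj v u \<sigma> k y = (\<Sum>i<k. (y \<bullet> v i) *\<^sub>R v i)"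
  unfolding trunc_proj_def comp_def trunc_pinv_def
  by (rule sum.cong) (use assms(2) in \<open>simp_all add: trunc_op_inner[OF assms(1)] less_imp_neq[symmetric]\<close>)

lemma bounded_linear_trunc_proj:
  assumes "orthonormal_seq u" and "\<And>i. 0 < \<sigma> i"
  shows "bounded_linear (trunc_proj v u \<sigma> k)"
proof -
  have "bounded_linear (\<lambda>y. \<Sum>i<k. (y \<bullet> v i) *\<^sub>R v i)"
    by (intro bounded_linear_sum bounded_linear_scaleR_const bounded_linear_inner_left)
  then show ?thesis
    by (simp add: trunc_proj_eq[OF assms, abs_def])
qed

text \<open>The coefficient of \<open>K y\<close> at \<open>u i\<close> is
  \<open>\<sigma> i * (y \<bullet> v i)\<close>, so the singular values cancel and the tail of the
  series is invisible. This rewrites the data term of the objective as the projection of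
  \<open>\<phi> j\<close>.\<close>

lemma trunc_pinv_singular_system:
  assumes "singular_system K v u \<sigma>"
  shows "trunc_pinv v u \<sigma> k (K y) = trunc_proj v u \<sigma> k y"
proof -
  have on: "orthonormal_seq u" and pos: "\<And>i. 0 < \<sigma> i"
    and K: "(\<lambda>i. (\<sigma> i * (y \<bullet> v i)) *\<^sub>R u i) sums K y"
    using assms by (auto simp: singular_system_def)
  show ?thesis
    unfolding trunc_proj_eq[OF on pos] trunc_pinv_def orthonormal_seq_sums_inner[OF on K]
    by (rule sum.cong) (simp_all add: less_imp_neq[OF pos, symmetric])
qed

text \<open>Both operators see only the first \<open>k\<close> coefficients in \<open>v\<close>, and
  the projection preserves these. The contrapositive carries non-collinearity from
  \<open>K\<^sub>k\<close> to \<open>P\<^sub>k\<close>.\<close>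

lemma trunc_op_scaled_if_trunc_proj_scaled:
  assumes "orthonormal_seq v" and "orthonormal_seq u" and "\<And>i. 0 < \<sigma> i"
    and "trunc_proj v u \<sigma> k y = c *\<^sub>R trunc_proj v u \<sigma> k z"
  shows "trunc_op v u \<sigma> k y = c *\<^sub>R trunc_op v u \<sigma> k z"
proof -
  have proj: "trunc_proj v u \<sigma> k x \<bullet> v m = x \<bullet> v m" if "m < k" for x m
    using that by (simp add: trunc_proj_eq[OF assms(2,3)] orthonormal_seq_inner_sum[OF assms(1)])
  have "y \<bullet> v m = c * (z \<bullet> v m)" if "m < k" for m
    using proj[OF that, of y] proj[OF that, of z] assms(4) by simp
  then show ?thesis
    unfolding trunc_op_def scaleR_sum_right by (intro sum.cong) (simp_all add: mult_ac)
qed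

section \<open>Optimality and uniqueness for the truncated problem\<close>

theorem proposition3p3:
  fixes K :: "'a::{real_inner, complete_space} \<Rightarrow> 'b::{real_inner, complete_space}"
    and v \<phi> :: "nat \<Rightarrow> 'a" and u :: "nat \<Rightarrow> 'b" and \<sigma> :: "nat \<Rightarrow> real"
    and k j :: nat and \<tau> \<alpha> :: real
  defines "K\<^sub>k \<equiv> trunc_op v u \<sigma> k"
    and "K\<^sub>k_pinv \<equiv> trunc_pinv v u \<sigma> k"
    and "P\<^sub>k \<equiv> trunc_proj v u \<sigma> k"
  defines "F \<equiv> weighted_l1_objective P\<^sub>k (K\<^sub>k_pinv (K (\<phi> j))) \<alpha> (weight P\<^sub>k \<phi> \<tau>) \<phi>"
    and "x \<equiv> (1 - \<alpha> / norm (P\<^sub>k (\<phi> j))) *\<^sub>R \<phi> j"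
  assumes "infinite_dimensional TYPE('a)" and "separable_space (euclidean :: 'a topology)"
    and "infinite_dimensional TYPE('b)" and "separable_space (euclidean :: 'b topology)"
    and "compact_operator K" and "inj K"
    and "singular_system K v u \<sigma>"
    and "orthonormal_basis \<phi>"
    and "k \<ge> 1" and "\<tau> > 0"
    and "norm (P\<^sub>k (\<phi> j)) \<ge> \<tau>"
    and "\<alpha> \<in> {0<..<norm (P\<^sub>k (\<phi> j))}"
  shows "global_minimizer F x \<and>
    ((\<forall>l q. l \<noteq> q \<longrightarrow> (\<forall>c::real. K\<^sub>k (\<phi> l) \<noteq> c *\<^sub>R K\<^sub>k (\<phi> q))) \<longrightarrow>
       (\<forall>z. global_minimizer F z \<longrightarrow> z = x))"
proof -
  have on: "orthonormal_seq v" "orthonormal_seq u" and pos: "\<And>i. 0 < \<sigma> i"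
    using \<open>singular_system K v u \<sigma>\<close> by (auto simp: singular_system_def orthonormal_basis_def)
  define w where "w = weight P\<^sub>k \<phi> \<tau>"
  have F: "F = weighted_l1_objective P\<^sub>k (P\<^sub>k (\<phi> j)) \<alpha> w \<phi>"
    using trunc_pinv_singular_system[OF \<open>singular_system K v u \<sigma>\<close>]
    by (simp add: F_def K\<^sub>k_pinv_def P\<^sub>k_def w_def)
  have bl: "bounded_linear P\<^sub>k"
    unfolding P\<^sub>k_def by (rule bounded_linear_trunc_proj[OF on(2) pos])
  have w: "norm (P\<^sub>k (\<phi> i)) \<le> w i" for i
    by (simp add: w_def weight_def)
  have wj: "w j = norm (P\<^sub>k (\<phi> j))"
    using \<open>norm (P\<^sub>k (\<phi> j)) \<ge> \<tau>\<close> by (simp add: w_def weight_def)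
  have \<alpha>: "0 < \<alpha>" "\<alpha> < norm (P\<^sub>k (\<phi> j))"
    using \<open>\<alpha> \<in> {0<..<norm (P\<^sub>k (\<phi> j))}\<close> by auto
  have Fx: "F x = ereal (\<alpha> * norm (P\<^sub>k (\<phi> j)) - \<alpha>\<^sup>2 / 2)"
    unfolding F x_def
    using weighted_l1_objective_atom[of \<phi> P\<^sub>k w j \<alpha>] \<open>orthonormal_basis \<phi>\<close>
      bounded_linear.linear[OF bl] wj \<alpha> by (simp add: orthonormal_basis_def)
  have "global_minimizer F x"
    unfolding global_minimizer_def Fx
    using objective_lower_bound[OF \<open>orthonormal_basis \<phi>\<close> bl w wj \<alpha>] by (simp add: F)
  moreover have "z = x"
    if indep: "\<forall>l q. l \<noteq> q \<longrightarrow> (\<forall>c::real. K\<^sub>k (\<phi> l) \<noteq> c *\<^sub>R K\<^sub>k (\<phi> q))"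
      and z: "global_minimizer F z" for z
  proof -
    \<comment> \<open>This is the hypothesis at \<open>q = j\<close>; its case \<open>c = 0\<close>
      also rules out \<open>P\<^sub>k (\<phi> i) = 0\<close>.\<close>
    have noncollinear: "P\<^sub>k (\<phi> i) \<noteq> c *\<^sub>R P\<^sub>k (\<phi> j)" if "i \<noteq> j" for i c
    proof
      assume "P\<^sub>k (\<phi> i) = c *\<^sub>R P\<^sub>k (\<phi> j)"
      then have "K\<^sub>k (\<phi> i) = c *\<^sub>R K\<^sub>k (\<phi> j)"
        unfolding P\<^sub>k_def K\<^sub>k_def by (rule trunc_op_scaled_if_trunc_proj_scaled[OF on pos])
      then show False
        using indep that by simp
    qed
    \<comment> \<open>Two global minimizers share their value, so \<open>z\<close> attains the lower
      bound as well.\<close>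
    have "F z = F x"
      using z \<open>global_minimizer F x\<close> by (simp add: global_minimizer_def antisym)
    then have "weighted_l1_objective P\<^sub>k (P\<^sub>k (\<phi> j)) \<alpha> w \<phi> z =
        ereal (\<alpha> * norm (P\<^sub>k (\<phi> j)) - \<alpha>\<^sup>2 / 2)"
      unfolding Fx unfolding F .
    with \<open>orthonormal_basis \<phi>\<close> bl w wj \<alpha> noncollinear show ?thesis
      unfolding x_def by (rule objective_minimum_unique)
  qed
  ultimately show ?thesis
    by blast
qed

end
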